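(* Let $R_5(n)$ be the number of partitions of $n$ with max-rook number $5$. For every integer $n>25$, $$R_5(n)\equiv\begin{cases} 0 \pmod 2, & \text{if } n\equiv 5,7 \pmod 8,\\ 1 \pmod 2, & \text{if } n\equiv 0,1,2,3,4,6 \pmod 8.\end{cases}$$
   Context: A partition $\pi$ of a positive integer $n$ is a non-increasing sequence of positive integers $(\lambda_1,\dots,\lambda_r)$ with sum $n$; $\mathscr{P}(n)$ is the set of all partitions of $n$. The Ferrers board $B_\pi$ of $\pi=(\lambda_1,\dots,\lambda_r)$ is the left-justified array of unit squares with $r$ rows whose $i$-th row from the top has $\lambda_i$ squares. Rooks placed on squares of the board are non-intersecting if no two of them lie in the same row or the same column. The max-rook number $R(\pi)$ is the maximal number of non-intersecting rooks that can be placed in $B_\pi$. For positive integers $n,k$, $R_k(n):=\#\{\pi\in\mathscr{P}(n) : R(\pi)=k\}$. *)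

theory Defs
  imports Main "HOL-Number_Theory.Cong"
begin

definition partitions_of :: "nat \<Rightarrow> nat list set" where
  "partitions_of n =
     {\<pi>. sorted_wrt (\<ge>) \<pi> \<and> (\<forall>x\<in>set \<pi>. x > 0) \<and> sum_list \<pi> = n}"

(* Squares are pairs (row, column), both counted from 0; row i has \<pi> ! i squares. *)
definition ferrers_board :: "nat list \<Rightarrow> (nat \<times> nat) set" where
  "ferrers_board \<pi> = {(i, j). i < length \<pi> \<and> j < \<pi> ! i}"

definition non_intersecting :: "(nat \<times> nat) set \<Rightarrow> bool" where
  "non_intersecting S \<longleftrightarrow>
     (\<forall>p\<in>S. \<forall>q\<in>S. p \<noteq> q \<longrightarrow> fst p \<noteq> fst q \<and> snd p \<noteq> snd q)"

definition max_rook :: "nat list \<Rightarrow> nat" where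
  "max_rook \<pi> = Max {card S | S. S \<subseteq> ferrers_board \<pi> \<and> non_intersecting S}"

definition R :: "nat \<Rightarrow> nat \<Rightarrow> nat" where
  "R k n = card {\<pi> \<in> partitions_of n. max_rook \<pi> = k}"

(* The next lemmas show that Max and card above are taken over finite sets (nonempty for Max). *)

lemma finite_ferrers_board: "finite (ferrers_board \<pi>)"
proof -
  have "ferrers_board \<pi> = Sigma {..<length \<pi>} (\<lambda>i. {..<\<pi> ! i})"
    by (auto simp: ferrers_board_def)
  then show ?thesis by simp
qed

lemma finite_rook_numbers:
  "finite {card S | S. S \<subseteq> ferrers_board \<pi> \<and> non_intersecting S}"
proof -
  have "{card S | S. S \<subseteq> ferrers_board \<pi> \<and> non_intersecting S} \<subseteq> card ` Pow (ferrers_board \<pi>)"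
    by auto
  then show ?thesis
    by (rule finite_subset) (simp add: finite_ferrers_board)
qed

lemma rook_numbers_nonempty:
  "{card S | S. S \<subseteq> ferrers_board \<pi> \<and> non_intersecting S} \<noteq> {}"
proof -
  have "non_intersecting {}" by (simp add: non_intersecting_def)
  then show ?thesis by blast
qed

lemma length_le_sum_list:
  fixes xs :: "nat list"
  shows "\<forall>x\<in>set xs. x > 0 \<Longrightarrow> length xs \<le> sum_list xs"
  by (induction xs) auto

lemma finite_partitions_of: "finite (partitions_of n)"
proof -
  have "partitions_of n \<subseteq> {xs. set xs \<subseteq> {..n} \<and> length xs \<le> n}"
    using length_le_sum_list member_le_sum_list by (fastforce simp: partitions_of_def)
  then show ?thesis
    by (rule finite_subset) (simp add: finite_lists_length_le)
qed

end

theory Submission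
  imports Defs
begin

text \<open>
  A Ferrers board carries \<open>k\<close> non-intersecting rooks iff it contains the antidiagonal
  \<open>{(i, j). i + j = k - 1}\<close>. The antidiagonal itself is a placement; and if a square \<open>(i, j)\<close>
  of it is missing, the board is covered by its first \<open>i\<close> rows and first \<open>j\<close> columns, so it has
  room for at most \<open>i + j = k - 1\<close> rooks (\<open>le_max_rook_iff\<close>). This criterion is invariant under
  conjugation, an involution on the partitions of \<open>n\<close> with max-rook number \<open>k\<close>; so \<open>R k n\<close> has
  the parity of the number of self-conjugate ones (\<open>R_cong_self_conjugate\<close>).

  For \<open>k = 5\<close> and \<open>n > 25\<close> these can be listed
  (\<open>self_conjugate_rook_diagrams_5_cases\<close>). A square \<open>(a, 5 - a)\<close> is missing for some
  \<open>a \<in> {0, 1, 2}\<close>. If \<open>a = 0\<close>, the diagram lies in a 5 by 5 square and \<open>n \<le> 25\<close>. Otherwise the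
  diagram consists of nested symmetric hooks, and it is one of
  \<^item> two hooks with first row \<open>m\<close> and second row \<open>k\<close>, where \<open>4 \<le> k \<le> m\<close>, and the square
    \<open>(2, 2)\<close>; its size is \<open>2 m + 2 k - 3\<close>;
  \<^item> one hook with first row \<open>m\<close> around a 3 by 3 square; its size is \<open>2 m + 8\<close>;
  \<^item> the same without the corner of the 3 by 3 square; its size is \<open>2 m + 7\<close>.

  Hence there is exactly one such diagram if \<open>n\<close> is even. If \<open>n\<close> is odd, there is one of the third
  kind, and those of the first kind correspond to the \<open>k\<close> with \<open>4 \<le> k \<le> (n + 3) / 4\<close>. The parity
  of the total \<open>(n + 3) div 4 - 2\<close> depends only on \<open>n mod 8\<close>.
\<close>

section \<open>Young diagrams as sets of squares\<close>

text \<open>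
  A Young diagram is a finite set of squares (row, column), counted from 0, that is closed under
  moving up and to the left. On such sets conjugation is simply the image under \<open>prod.swap\<close>.
\<close>
definition young_diagram :: "(nat \<times> nat) set \<Rightarrow> bool" where
  "young_diagram D \<longleftrightarrow> finite D \<and>
     (\<forall>i j i' j'. (i, j) \<in> D \<longrightarrow> i' \<le> i \<longrightarrow> j' \<le> j \<longrightarrow> (i', j') \<in> D)"

lemma young_diagramD:
  assumes "young_diagram D" "(i, j) \<in> D" "i' \<le> i" "j' \<le> j"
  shows "(i', j') \<in> D"
  using assms unfolding young_diagram_def by blast

lemma finite_young_diagram: "young_diagram D \<Longrightarrow> finite D"
  by (simp add: young_diagram_def)

lemma finite_down_closed_eq_lessThan:
  fixes A :: "nat set"
  assumes "finite A" "\<And>i j. j \<in> A \<Longrightarrow> i \<le> j \<Longrightarrow> i \<in> A"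
  shows "A = {..<card A}"
proof -
  have "\<exists>m. m \<notin> A"
    using assms(1) by (meson ex_new_if_finite infinite_UNIV_nat)
  define m where "m = (LEAST m. m \<notin> A)"
  have "m \<notin> A"
    unfolding m_def using \<open>\<exists>m. m \<notin> A\<close> by (rule LeastI_ex)
  moreover have "i \<in> A" if "i < m" for i
    using not_less_Least[of i "\<lambda>m. m \<notin> A"] that by (auto simp: m_def)
  ultimately have "A = {..<m}"
    using assms(2) by (metis lessThan_iff linorder_not_less subsetI subset_antisym)
  then show ?thesis by simp
qed

lemma young_diagram_row:
  assumes "young_diagram D"
  shows "(i, j) \<in> D \<longleftrightarrow> j < card {j. (i, j) \<in> D}"
proof -
  have "finite (snd ` D)"
    using finite_young_diagram[OF assms] by simp
  moreover have "{j. (i, j) \<in> D} \<subseteq> snd ` D"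
    by force
  ultimately have "finite {j. (i, j) \<in> D}"
    by (rule rev_finite_subset)
  then have "{j. (i, j) \<in> D} = {..<card {j. (i, j) \<in> D}}"
    by (rule finite_down_closed_eq_lessThan) (auto intro: young_diagramD[OF assms])
  then show ?thesis by blast
qed

lemma young_diagram_swap:
  assumes "young_diagram D"
  shows "young_diagram (prod.swap ` D)"
proof -
  have "(i, j) \<in> prod.swap ` D \<longleftrightarrow> (j, i) \<in> D" for i j
    by force
  then show ?thesis
    using assms unfolding young_diagram_def by auto
qed

lemma young_diagram_col:
  assumes "young_diagram D"
  shows "(i, j) \<in> D \<longleftrightarrow> i < card {i. (i, j) \<in> D}"
proof -
  have swap: "(a, b) \<in> prod.swap ` D \<longleftrightarrow> (b, a) \<in> D" for a b
    by force
  show ?thesis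
    using young_diagram_row[OF young_diagram_swap[OF assms], of j i] unfolding swap .
qed

lemma young_diagram_ferrers_board:
  assumes "sorted_wrt (\<ge>) \<pi>"
  shows "young_diagram (ferrers_board \<pi>)"
  unfolding young_diagram_def
proof (intro conjI allI impI finite_ferrers_board)
  fix i j i' j'
  assume "(i, j) \<in> ferrers_board \<pi>" and le: "i' \<le> i" "j' \<le> j"
  then have *: "i < length \<pi>" "j < \<pi> ! i"
    by (auto simp: ferrers_board_def)
  have "\<pi> ! i \<le> \<pi> ! i'"
    using sorted_wrt_nth_less[OF assms, of i' i] le * by (cases "i' = i") auto
  then show "(i', j') \<in> ferrers_board \<pi>"
    using * le by (auto simp: ferrers_board_def)
qed

lemma card_ferrers_board: "card (ferrers_board \<pi>) = sum_list \<pi>"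
proof -
  have "ferrers_board \<pi> = Sigma {..<length \<pi>} (\<lambda>i. {..<\<pi> ! i})"
    by (auto simp: ferrers_board_def)
  then show ?thesis
    by (simp add: sum_list_sum_nth atLeast0LessThan)
qed

lemma bij_betw_ferrers_board:
  "bij_betw ferrers_board (partitions_of n) {D. young_diagram D \<and> card D = n}"
proof (rule bij_betw_imageI)
  show "inj_on ferrers_board (partitions_of n)"
  proof (rule inj_onI)
    fix \<pi> \<rho>
    assume mem: "\<pi> \<in> partitions_of n" "\<rho> \<in> partitions_of n"
      and eq: "ferrers_board \<pi> = ferrers_board \<rho>"
    have len: "{i. (i, 0) \<in> ferrers_board \<sigma>} = {..<length \<sigma>}" if "\<sigma> \<in> partitions_of n" for \<sigma>
      using that by (auto simp: ferrers_board_def partitions_of_def)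
    have row: "{j. (i, j) \<in> ferrers_board \<sigma>} = {..<\<sigma> ! i}" if "i < length \<sigma>" for i \<sigma>
      using that by (auto simp: ferrers_board_def)
    have "length \<pi> = length \<rho>"
      using len[OF mem(1)] len[OF mem(2)] eq by simp
    then show "\<pi> = \<rho>"
    proof (rule nth_equalityI)
      fix i assume "i < length \<pi>"
      then have "{..<\<pi> ! i} = {..<\<rho> ! i}"
        using row[of i \<pi>] row[of i \<rho>] eq \<open>length \<pi> = length \<rho>\<close> by simp
      then show "\<pi> ! i = \<rho> ! i" by simp
    qed
  qed
  show "ferrers_board ` partitions_of n = {D. young_diagram D \<and> card D = n}"
  proof (intro equalityI subsetI)
    fix D assume "D \<in> ferrers_board ` partitions_of n"
    then show "D \<in> {D. young_diagram D \<and> card D = n}"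
      by (auto simp: partitions_of_def card_ferrers_board intro: young_diagram_ferrers_board)
  next
    fix D assume "D \<in> {D. young_diagram D \<and> card D = n}"
    then have D: "young_diagram D" "card D = n" by auto
    define r where "r i = card {j. (i, j) \<in> D}" for i
    define l where "l = card {i. (i, 0) \<in> D}"
    define \<pi> where "\<pi> = map r [0..<l]"
    have r: "(i, j) \<in> D \<longleftrightarrow> j < r i" for i j
      unfolding r_def by (rule young_diagram_row[OF D(1)])
    have l: "(i, 0) \<in> D \<longleftrightarrow> i < l" for i
      unfolding l_def by (rule young_diagram_col[OF D(1)])
    have board: "ferrers_board \<pi> = D"
    proof -
      have "(i, j) \<in> ferrers_board \<pi> \<longleftrightarrow> i < l \<and> j < r i" for i j
        by (auto simp: ferrers_board_def \<pi>_def)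
      moreover have "(i, j) \<in> D \<Longrightarrow> i < l" for i j
        using l[of i] young_diagramD[OF D(1), of i j i 0] by simp
      ultimately have "p \<in> ferrers_board \<pi> \<longleftrightarrow> p \<in> D" for p
        using r by (cases p) blast
      then show ?thesis by blast
    qed
    have "r i' \<le> r i" if "i \<le> i'" for i i'
      using r[of i' "r i"] r[of i "r i"] young_diagramD[OF D(1) _ that order_refl, of "r i"]
      by (metis less_irrefl not_less)
    then have "sorted_wrt (\<ge>) \<pi>"
      by (auto simp: \<pi>_def sorted_wrt_iff_nth_less)
    moreover have "\<forall>x\<in>set \<pi>. x > 0"
      using l r by (auto simp: \<pi>_def)
    moreover have "sum_list \<pi> = n"
      using card_ferrers_board[of \<pi>] board D by simp
    ultimately have "\<pi> \<in> partitions_of n"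
      by (simp add: partitions_of_def)
    then show "D \<in> ferrers_board ` partitions_of n"
      using board by blast
  qed
qed

section \<open>The max-rook number and staircases\<close>

text \<open>
  The \<open>k\<close> squares of the antidiagonal \<open>i + j = k - 1\<close>. A Young diagram containing them contains
  the whole staircase \<open>(k, k - 1, \<dots>, 1)\<close>. For \<open>k = 0\<close> the condition is vacuous.
\<close>
definition contains_staircase :: "nat \<Rightarrow> (nat \<times> nat) set \<Rightarrow> bool" where
  "contains_staircase k D \<longleftrightarrow> (\<forall>i j. Suc (i + j) = k \<longrightarrow> (i, j) \<in> D)"

text \<open>
  The easy half of Koenig's theorem: a missing square \<open>(i, j)\<close> means that \<open>i\<close> rows and \<open>j\<close>
  columns cover the diagram, and each of these lines holds at most one rook.
\<close>
lemma card_non_intersecting_le: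
  assumes "young_diagram D" "(i, j) \<notin> D" "S \<subseteq> D" "non_intersecting S"
  shows "card S \<le> i + j"
proof -
  define U where "U = {p \<in> S. fst p < i}"
  define V where "V = {p \<in> S. snd p < j}"
  have "fst p < i \<or> snd p < j" if "p \<in> S" for p
    using young_diagramD[OF assms(1), of "fst p" "snd p" i j] assms(2,3) that
    by (metis prod.collapse linorder_not_less subsetD)
  then have S: "S = U \<union> V"
    unfolding U_def V_def by blast
  have "inj_on fst U"
    unfolding inj_on_def U_def using assms(4) by (metis (lifting) non_intersecting_def mem_Collect_eq)
  moreover have "inj_on snd V"
    unfolding inj_on_def V_def using assms(4) by (metis (lifting) non_intersecting_def mem_Collect_eq)
  moreover have "fst ` U \<subseteq> {..<i}" "snd ` V \<subseteq> {..<j}"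
    by (auto simp: U_def V_def)
  ultimately have "card U \<le> card {..<i}" "card V \<le> card {..<j}"
    by (auto intro: card_inj_on_le simp del: card_lessThan)
  then show ?thesis
    using card_Un_le[of U V] S by simp
qed

lemma le_max_rook_iff:
  assumes "sorted_wrt (\<ge>) \<pi>"
  shows "k \<le> max_rook \<pi> \<longleftrightarrow> contains_staircase k (ferrers_board \<pi>)"
proof
  assume le: "k \<le> max_rook \<pi>"
  have "max_rook \<pi> \<in> {card S | S. S \<subseteq> ferrers_board \<pi> \<and> non_intersecting S}"
    unfolding max_rook_def by (rule Max_in[OF finite_rook_numbers rook_numbers_nonempty])
  then obtain S where S: "S \<subseteq> ferrers_board \<pi>" "non_intersecting S" "card S = max_rook \<pi>"
    by auto
  show "contains_staircase k (ferrers_board \<pi>)"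
    unfolding contains_staircase_def
  proof (intro allI impI)
    fix i j assume "Suc (i + j) = k"
    then have "\<not> card S \<le> i + j" using S(3) le by simp
    then show "(i, j) \<in> ferrers_board \<pi>"
      using card_non_intersecting_le[OF young_diagram_ferrers_board[OF assms] _ S(1,2)] by blast
  qed
next
  assume stair: "contains_staircase k (ferrers_board \<pi>)"
  define S where "S = (\<lambda>i. (i, k - Suc i)) ` {..<k}"
  have "S \<subseteq> ferrers_board \<pi>"
    using stair by (auto simp: S_def contains_staircase_def)
  moreover have "non_intersecting S"
    by (auto simp: S_def non_intersecting_def)
  moreover have "card S = k"
    by (simp add: S_def card_image inj_on_def)
  ultimately show "k \<le> max_rook \<pi>"
    unfolding max_rook_def by (intro Max_ge[OF finite_rook_numbers]) auto
qed

text \<open>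
  The Young diagrams with \<open>n\<close> squares and max-rook number \<open>k\<close>, described by staircases alone.
\<close>
definition rook_diagrams :: "nat \<Rightarrow> nat \<Rightarrow> (nat \<times> nat) set set" where
  "rook_diagrams k n = {D. young_diagram D \<and> card D = n \<and>
     contains_staircase k D \<and> \<not> contains_staircase (Suc k) D}"

lemma ferrers_board_rook_diagrams:
  "bij_betw ferrers_board {\<pi> \<in> partitions_of n. max_rook \<pi> = k} (rook_diagrams k n)"
proof (rule bij_betw_imageI)
  show "inj_on ferrers_board {\<pi> \<in> partitions_of n. max_rook \<pi> = k}"
    using bij_betw_imp_inj_on[OF bij_betw_ferrers_board] by (rule inj_on_subset) auto
  have "max_rook \<pi> = k \<longleftrightarrow> contains_staircase k (ferrers_board \<pi>)
          \<and> \<not> contains_staircase (Suc k) (ferrers_board \<pi>)" if "\<pi> \<in> partitions_of n" for \<pi>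
    using that le_max_rook_iff[of \<pi> k] le_max_rook_iff[of \<pi> "Suc k"]
    by (auto simp: partitions_of_def)
  then have parts: "{\<pi> \<in> partitions_of n. max_rook \<pi> = k} =
      {\<pi> \<in> partitions_of n. contains_staircase k (ferrers_board \<pi>)
          \<and> \<not> contains_staircase (Suc k) (ferrers_board \<pi>)}"
    by blast
  have diagrams: "rook_diagrams k n = {D \<in> ferrers_board ` partitions_of n.
      contains_staircase k D \<and> \<not> contains_staircase (Suc k) D}"
    unfolding bij_betw_imp_surj_on[OF bij_betw_ferrers_board] rook_diagrams_def by blast
  show "ferrers_board ` {\<pi> \<in> partitions_of n. max_rook \<pi> = k} = rook_diagrams k n"
    unfolding parts diagrams by blast
qed

section \<open>Reduction to self-conjugate diagrams\<close>

lemma card_involution_cong_fixpoints: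
  assumes "finite S" "\<And>x. x \<in> S \<Longrightarrow> g x \<in> S" "\<And>x. x \<in> S \<Longrightarrow> g (g x) = x"
  shows "[card S = card {x \<in> S. g x = x}] (mod 2)"
  using assms
proof (induction S rule: finite_psubset_induct)
  case (psubset S)
  show ?case
  proof (cases "\<forall>x\<in>S. g x = x")
    case True
    then have "{x \<in> S. g x = x} = S" by auto
    then show ?thesis by simp
  next
    case False
    then obtain x where x: "x \<in> S" "g x \<noteq> x" by blast
    define T where "T = S - {x, g x}"
    have S: "S = insert x (insert (g x) T)" "x \<notin> insert (g x) T" "g x \<notin> T"
      using x psubset.prems(1) by (auto simp: T_def)
    have "T \<subset> S" using x by (auto simp: T_def)
    have "g y \<in> T" if "y \<in> T" for y
      using that psubset.prems x unfolding T_def by (metis DiffD1 DiffD2 DiffI insert_iff singletonD)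
    then have "[card T = card {y \<in> T. g y = y}] (mod 2)"
      by (intro psubset.IH[OF \<open>T \<subset> S\<close>]) (auto simp: T_def psubset.prems)
    moreover have "{y \<in> T. g y = y} = {y \<in> S. g y = y}"
      using x psubset.prems(2)[of x] psubset.prems(2) by (auto simp: T_def)
    moreover have "card S = card T + 2"
      using S(2,3) finite_subset[OF psubset_imp_subset[OF \<open>T \<subset> S\<close>] psubset.hyps]
      by (subst S(1)) simp
    ultimately show ?thesis
      by (simp add: cong_def)
  qed
qed

lemma R_cong_self_conjugate:
  "[R k n = card {D \<in> rook_diagrams k n. prod.swap ` D = D}] (mod 2)"
proof -
  have "finite {\<pi> \<in> partitions_of n. max_rook \<pi> = k}"
    using finite_partitions_of by simp
  then have fin: "finite (rook_diagrams k n)"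
    using bij_betw_finite[OF ferrers_board_rook_diagrams] by blast
  have swap: "(i, j) \<in> prod.swap ` D \<longleftrightarrow> (j, i) \<in> D" for i j :: nat and D
    by force
  have stair: "contains_staircase m (prod.swap ` D) \<longleftrightarrow> contains_staircase m D" for m D
    unfolding contains_staircase_def swap by (metis add.commute)
  have "prod.swap ` D \<in> rook_diagrams k n" if "D \<in> rook_diagrams k n" for D
    using that young_diagram_swap by (auto simp: rook_diagrams_def stair card_image)
  then have "[card (rook_diagrams k n) = card {D \<in> rook_diagrams k n. prod.swap ` D = D}] (mod 2)"
    by (intro card_involution_cong_fixpoints[OF fin]) (auto simp: image_image)
  then show ?thesis
    using bij_betw_same_card[OF ferrers_board_rook_diagrams[of n k]] by (simp add: R_def)
qed

section \<open>The self-conjugate diagrams with max-rook number five\<close>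

text \<open>
  The symmetric hook with corner \<open>(a, a)\<close> whose two arms end just before row and column \<open>m\<close>.
\<close>
definition arms :: "nat \<Rightarrow> nat \<Rightarrow> (nat \<times> nat) set" where
  "arms a m = {(i, j). (i = a \<and> a \<le> j \<and> j < m) \<or> (j = a \<and> a \<le> i \<and> i < m)}"

lemma arms_iff: "(i, j) \<in> arms a m \<longleftrightarrow> (i = a \<and> a \<le> j \<and> j < m) \<or> (j = a \<and> a \<le> i \<and> i < m)"
  by (simp add: arms_def)

lemma finite_arms: "finite (arms a m)"
  by (rule finite_subset[of _ "{..<m} \<times> {..<m}"]) (auto simp: arms_def)

lemma card_arms:
  assumes "a < m"
  shows "card (arms a m) = 2 * (m - a) - 1"
proof -
  have "arms a m = ({a} \<times> {a..<m}) \<union> ({Suc a..<m} \<times> {a})"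
    using assms by (auto simp: arms_def)
  moreover have "({a} \<times> {a..<m}) \<inter> ({Suc a..<m} \<times> {a}) = {}"
    by auto
  ultimately have "card (arms a m) = (m - a) + (m - Suc a)"
    by (simp add: card_Un_disjoint card_cartesian_product)
  then show ?thesis using assms by simp
qed

text \<open>
  The next three definitions are the self-conjugate diagrams of the partitions
  \<open>(m, k, 3, 2, \<dots>, 2, 1, \<dots>, 1)\<close>, \<open>(m, 4, 4, 4, 1, \<dots>, 1)\<close> and
  \<open>(m, 4, 4, 3, 1, \<dots>, 1)\<close>, provided that \<open>4 \<le> k \<le> m\<close> in the first one and \<open>4 \<le> m\<close> in the
  other two. In \<open>two_hooks\<close>, \<open>arms 2 3\<close> is the single square \<open>(2, 2)\<close>.
\<close>
definition two_hooks :: "nat \<Rightarrow> nat \<Rightarrow> (nat \<times> nat) set" where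
  "two_hooks m k = arms 0 m \<union> arms 1 k \<union> arms 2 3"

definition hook_square :: "nat \<Rightarrow> (nat \<times> nat) set" where
  "hook_square m = arms 0 m \<union> {1..3} \<times> {1..3}"

definition hook_notched_square :: "nat \<Rightarrow> (nat \<times> nat) set" where
  "hook_notched_square m = hook_square m - {(3, 3)}"

lemma arms_disjoint: "a \<noteq> b \<Longrightarrow> arms a m \<inter> arms b k = {}"
  by (auto simp: arms_def)

lemma card_two_hooks:
  assumes "4 \<le> k" "k \<le> m"
  shows "card (two_hooks m k) = 2 * m + 2 * k - 3"
  unfolding two_hooks_def using assms
  by (simp add: card_Un_disjoint finite_arms arms_disjoint Int_Un_distrib2 card_arms)

lemma card_hook_square:
  assumes "5 \<le> m"
  shows "card (hook_square m) = 2 * m + 8"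
proof -
  have "arms 0 m \<inter> {1..3} \<times> {1..3} = {}"
    by (auto simp: arms_def)
  then show ?thesis
    using assms by (simp add: hook_square_def card_Un_disjoint finite_arms card_arms)
qed

lemma card_hook_notched_square:
  assumes "5 \<le> m"
  shows "card (hook_notched_square m) = 2 * m + 7"
proof -
  have "(3, 3) \<in> hook_square m"
    by (simp add: hook_square_def)
  then show ?thesis
    using card_hook_square[OF assms] by (simp add: hook_notched_square_def)
qed

lemma swap_image_eq_iff:
  "prod.swap ` D = D \<longleftrightarrow> (\<forall>i j. (i, j) \<in> D \<longleftrightarrow> (j, i) \<in> D)" for D :: "('a \<times> 'a) set"
proof -
  have "(i, j) \<in> prod.swap ` D \<longleftrightarrow> (j, i) \<in> D" for i j
    by force
  then show ?thesis by (auto simp: set_eq_iff)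
qed

lemma swap_arms: "prod.swap ` arms a m = arms a m"
  by (auto simp: swap_image_eq_iff arms_def)

lemma contains_staircase_iff: "contains_staircase k D \<longleftrightarrow> (\<forall>i<k. (i, k - Suc i) \<in> D)"
proof -
  have "Suc (i + j) = k \<longleftrightarrow> i < k \<and> j = k - Suc i" for i j
    by auto
  then show ?thesis by (auto simp: contains_staircase_def)
qed

lemma staircase_5:
  "contains_staircase 5 D \<longleftrightarrow>
     (0, 4) \<in> D \<and> (1, 3) \<in> D \<and> (2, 2) \<in> D \<and> (3, 1) \<in> D \<and> (4, 0) \<in> D"
  unfolding contains_staircase_iff by (auto simp: numeral_eq_Suc All_less_Suc)

lemma staircase_6:
  "contains_staircase 6 D \<longleftrightarrow>
     (0, 5) \<in> D \<and> (1, 4) \<in> D \<and> (2, 3) \<in> D \<and> (3, 2) \<in> D \<and> (4, 1) \<in> D \<and> (5, 0) \<in> D"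
  unfolding contains_staircase_iff by (auto simp: numeral_eq_Suc All_less_Suc)

lemma two_hooks_mem:
  assumes "4 \<le> k" "k \<le> m" "5 \<le> m"
  shows "two_hooks m k \<in> rook_diagrams 5 (2 * m + 2 * k - 3)" "prod.swap ` two_hooks m k = two_hooks m k"
proof -
  have "young_diagram (two_hooks m k)"
    unfolding young_diagram_def two_hooks_def using assms
    by (auto simp: finite_arms arms_iff)
  then show "two_hooks m k \<in> rook_diagrams 5 (2 * m + 2 * k - 3)"
    using assms card_two_hooks[OF assms(1,2)]
    by (auto simp: rook_diagrams_def staircase_5 staircase_6 two_hooks_def arms_iff)
  show "prod.swap ` two_hooks m k = two_hooks m k"
    by (simp add: two_hooks_def image_Un swap_arms)
qed

lemma hook_square_mem:
  assumes "5 \<le> m"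
  shows "hook_square m \<in> rook_diagrams 5 (2 * m + 8)" "prod.swap ` hook_square m = hook_square m"
proof -
  have "young_diagram (hook_square m)"
    unfolding young_diagram_def hook_square_def using assms
    by (auto simp: finite_arms arms_iff)
  then show "hook_square m \<in> rook_diagrams 5 (2 * m + 8)"
    using assms card_hook_square[OF assms]
    by (auto simp: rook_diagrams_def staircase_5 staircase_6 hook_square_def arms_iff)
  show "prod.swap ` hook_square m = hook_square m"
    by (simp add: hook_square_def image_Un swap_arms product_swap)
qed

lemma hook_notched_square_mem:
  assumes "5 \<le> m"
  shows "hook_notched_square m \<in> rook_diagrams 5 (2 * m + 7)"
    "prod.swap ` hook_notched_square m = hook_notched_square m"
proof -
  have "young_diagram (hook_notched_square m)"
    unfolding young_diagram_def hook_notched_square_def hook_square_def using assms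
    by (auto simp: finite_arms arms_iff)
  then show "hook_notched_square m \<in> rook_diagrams 5 (2 * m + 7)"
    using assms card_hook_notched_square[OF assms]
    by (auto simp: rook_diagrams_def staircase_5 staircase_6 hook_notched_square_def hook_square_def arms_iff)
  show "prod.swap ` hook_notched_square m = hook_notched_square m"
    using hook_square_mem(2)[OF assms] by (simp add: hook_notched_square_def image_set_diff)
qed

lemma symmetric_diagram_eqI:
  fixes D E :: "(nat \<times> nat) set"
  assumes "prod.swap ` D = D" "prod.swap ` E = E"
    and "\<And>i j. i \<le> j \<Longrightarrow> (i, j) \<in> D \<longleftrightarrow> (i, j) \<in> E"
  shows "D = E"
proof -
  have "(i, j) \<in> D \<longleftrightarrow> (i, j) \<in> E" for i j
    using assms unfolding swap_image_eq_iff by (metis nat_le_linear)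
  then show ?thesis by auto
qed

text \<open>
  The only use of \<open>25 < n\<close> is to force the square \<open>(0, 5)\<close>, so that \<open>(1, 4)\<close> or \<open>(2, 3)\<close> is
  missing. The parameters \<open>m\<close> and \<open>k\<close> are the lengths of rows 0 and 1.
\<close>
lemma self_conjugate_rook_diagrams_5_cases:
  assumes D: "D \<in> rook_diagrams 5 n" and sym: "prod.swap ` D = D" and n: "25 < n"
  obtains (two_hooks) m k where "4 \<le> k" "k \<le> m" "5 \<le> m" "D = two_hooks m k"
    | (hook_square) m where "5 \<le> m" "D = hook_square m"
    | (hook_notched_square) m where "5 \<le> m" "D = hook_notched_square m"
proof -
  have Y: "young_diagram D" and "card D = n"
    and st: "(0, 4) \<in> D" "(1, 3) \<in> D" "(2, 2) \<in> D"
    using D by (auto simp: rook_diagrams_def staircase_5)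
  note down = young_diagramD[OF Y]
  have sym': "(i, j) \<in> D \<longleftrightarrow> (j, i) \<in> D" for i j
    using sym unfolding swap_image_eq_iff by blast
  have corner: "(0, 5) \<notin> D \<or> (1, 4) \<notin> D \<or> (2, 3) \<notin> D"
    using D sym' by (auto simp: rook_diagrams_def staircase_6)
  define r where "r i = card {j. (i, j) \<in> D}" for i
  have r: "(i, j) \<in> D \<longleftrightarrow> j < r i" for i j
    unfolding r_def by (rule young_diagram_row[OF Y])
  have r_mono: "r i' \<le> r i" if "i \<le> i'" for i i'
    using r[of i' "r i"] r[of i "r i"] down[OF _ that order_refl, of "r i"]
    by (metis less_irrefl not_less)
  have r0: "(0, 5) \<in> D"
  proof (rule ccontr)
    assume "(0, 5) \<notin> D"
    then have "(i, j) \<in> D \<Longrightarrow> i < 5 \<and> j < 5" for i j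
      using sym' down[of i j 0 5] down[of i j 5 0] by (metis le0 linorder_not_less)
    then have "D \<subseteq> {..<5} \<times> {..<5}" by auto
    then have "card D \<le> 25"
      using card_mono[of "{..<5::nat} \<times> {..<5::nat}" D] by (simp add: card_cartesian_product)
    then show False using n \<open>card D = n\<close> by simp
  qed
  have rows: "6 \<le> r 0" "4 \<le> r 1" "3 \<le> r 2" "r 1 \<le> r 0" "r 2 \<le> r 1" "r 3 \<le> r 2"
    using r0 st r_mono by (auto simp: r Suc_le_eq)
  show ?thesis
  proof (cases "(2, 3) \<in> D")
    case False
    have "D = two_hooks (r 0) (r 1)"
    proof (rule symmetric_diagram_eqI[OF sym])
      show "prod.swap ` two_hooks (r 0) (r 1) = two_hooks (r 0) (r 1)"
        using rows by (intro two_hooks_mem) auto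
      fix i j :: nat assume "i \<le> j"
      have r2: "r 2 = 3" using False rows r by simp
      consider "i = 0" | "i = 1" | "i = 2" | "3 \<le> i" by linarith
      then show "(i, j) \<in> D \<longleftrightarrow> (i, j) \<in> two_hooks (r 0) (r 1)"
      proof cases
        case 4
        then have "(i, j) \<notin> D"
          using False \<open>i \<le> j\<close> down[of i j 2 3] by auto
        then show ?thesis
          using 4 \<open>i \<le> j\<close> by (auto simp: two_hooks_def arms_iff)
      qed (use \<open>i \<le> j\<close> r2 in \<open>auto simp: two_hooks_def arms_iff r\<close>)
    qed
    then show thesis using rows by (intro that(1)[of "r 1" "r 0"]) auto
  next
    case True
    then have "(1, 4) \<notin> D" using corner r0 by simp
    then have r12: "r 1 = 4" "r 2 = 4"
      using True rows r by (auto simp: not_less)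
    have r4: "(i, j) \<notin> D" if "4 \<le> i" "i \<le> j" for i j
      using \<open>(1, 4) \<notin> D\<close> that down[of i j 1 4] by auto
    have r3: "j = 3" if "(3, j) \<in> D" "3 \<le> j" for j
      using that \<open>(1, 4) \<notin> D\<close> down[of 3 j 1 4] by force
    show thesis
    proof (cases "(3, 3) \<in> D")
      case d: True
      have "D = hook_square (r 0)"
      proof (rule symmetric_diagram_eqI[OF sym])
        show "prod.swap ` hook_square (r 0) = hook_square (r 0)"
          using rows by (intro hook_square_mem) auto
        fix i j :: nat assume "i \<le> j"
        have "i = 0 \<or> i = 1 \<or> i = 2 \<or> i = 3 \<or> 4 \<le> i" by arith
        moreover have "(3, j) \<in> D \<longleftrightarrow> j = 3" if "3 \<le> j"
          using d r3 that by blast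
        ultimately show "(i, j) \<in> D \<longleftrightarrow> (i, j) \<in> hook_square (r 0)"
          using \<open>i \<le> j\<close> rows r12 r4[of i j] by (auto simp: hook_square_def arms_iff r)
      qed
      then show thesis using rows by (intro that(2)[of "r 0"]) auto
    next
      case d: False
      have "D = hook_notched_square (r 0)"
      proof (rule symmetric_diagram_eqI[OF sym])
        show "prod.swap ` hook_notched_square (r 0) = hook_notched_square (r 0)"
          using rows by (intro hook_notched_square_mem) auto
        fix i j :: nat assume "i \<le> j"
        have "i = 0 \<or> i = 1 \<or> i = 2 \<or> i = 3 \<or> 4 \<le> i" by arith
        moreover have "(3, j) \<notin> D" if "3 \<le> j"
          using d r3 that by blast
        ultimately show "(i, j) \<in> D \<longleftrightarrow> (i, j) \<in> hook_notched_square (r 0)"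
          using \<open>i \<le> j\<close> rows r12 r4[of i j] by (auto simp: hook_notched_square_def hook_square_def arms_iff r)
      qed
      then show thesis using rows by (intro that(3)[of "r 0"]) auto
    qed
  qed
qed

lemma card_self_conjugate_even:
  assumes "25 < n" "even n"
  shows "card {D \<in> rook_diagrams 5 n. prod.swap ` D = D} = 1"
proof -
  define m where "m = (n - 8) div 2"
  have m: "n = 2 * m + 8" "5 \<le> m"
    using assms by (auto simp: m_def elim!: evenE)
  have "{D \<in> rook_diagrams 5 n. prod.swap ` D = D} = {hook_square m}"
  proof (intro equalityI subsetI)
    fix D assume "D \<in> {D \<in> rook_diagrams 5 n. prod.swap ` D = D}"
    then have D: "D \<in> rook_diagrams 5 n" "prod.swap ` D = D" "card D = n"
      by (auto simp: rook_diagrams_def)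
    show "D \<in> {hook_square m}"
      using D(1,2) assms(1)
    proof (cases rule: self_conjugate_rook_diagrams_5_cases)
      case (two_hooks m' k)
      then have "n = 2 * (m' + k - 2) + 1"
        using card_two_hooks[of k m'] D(3) by simp
      then show ?thesis using assms(2) by simp
    next
      case (hook_square m')
      then show ?thesis using card_hook_square[of m'] D(3) m by simp
    next
      case (hook_notched_square m')
      then have "n = 2 * (m' + 3) + 1"
        using card_hook_notched_square[of m'] D(3) by simp
      then show ?thesis using assms(2) by simp
    qed
  next
    fix D assume "D \<in> {hook_square m}"
    then show "D \<in> {D \<in> rook_diagrams 5 n. prod.swap ` D = D}"
      using hook_square_mem[OF m(2)] m(1) by simp
  qed
  then show ?thesis by simp
qed

text \<open>
  The second row determines \<open>k\<close>; this suffices to count the \<open>two_hooks\<close> diagrams of a fixed size,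
  where \<open>m\<close> is a function of \<open>k\<close>.
\<close>
lemma two_hooks_inject:
  assumes "4 \<le> k" "4 \<le> k'" "two_hooks m k = two_hooks m' k'"
  shows "k = k'"
proof -
  \<comment> \<open>Column 0 is left out because there the first hook contributes depending on \<open>m\<close>.\<close>
  have "{j. (1, j) \<in> two_hooks a b} - {0} = {1..<b}" if "4 \<le> b" for a b
    using that by (auto simp: two_hooks_def arms_iff)
  then have "{1..<k} = {1..<k'}"
    using assms by metis
  then have "card {1..<k} = card {1..<k'}" by simp
  then show ?thesis using assms(1,2) by simp
qed

lemma hook_notched_square_neq_two_hooks: "hook_notched_square m \<noteq> two_hooks m' k"
proof -
  have "(2, 3) \<in> hook_notched_square m" "(2, 3) \<notin> two_hooks m' k"
    by (auto simp: hook_notched_square_def hook_square_def two_hooks_def arms_iff)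
  then show ?thesis by metis
qed

lemma card_self_conjugate_odd:
  assumes "25 < n" "odd n"
  shows "card {D \<in> rook_diagrams 5 n. prod.swap ` D = D} = (n + 3) div 4 - 2"
proof -
  \<comment> \<open>For odd \<open>n\<close> this is the value of \<open>m + k\<close> in the equation \<open>2 m + 2 k - 3 = n\<close>.\<close>
  define s where "s = (n + 3) div 2"
  have s: "n = 2 * s - 3" "14 < s"
    using assms by (auto simp: s_def elim!: oddE)
  define K where "K = {4..s div 2}"
  define F where "F = (\<lambda>k. two_hooks (s - k) k) ` K"
  have "{D \<in> rook_diagrams 5 n. prod.swap ` D = D} = insert (hook_notched_square (s - 5)) F"
  proof (intro equalityI subsetI)
    fix D assume "D \<in> {D \<in> rook_diagrams 5 n. prod.swap ` D = D}"
    then have D: "D \<in> rook_diagrams 5 n" "prod.swap ` D = D" "card D = n"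
      by (auto simp: rook_diagrams_def)
    show "D \<in> insert (hook_notched_square (s - 5)) F"
      using D(1,2) assms(1)
    proof (cases rule: self_conjugate_rook_diagrams_5_cases)
      case (two_hooks m k)
      then have "s = m + k"
        using card_two_hooks[of k m] D(3) s by simp
      then have "m = s - k" "k \<in> K"
        using two_hooks by (auto simp: K_def)
      then show ?thesis using two_hooks by (auto simp: F_def)
    next
      case (hook_square m)
      then have "n = 2 * (m + 4)"
        using card_hook_square[of m] D(3) by simp
      then show ?thesis using assms(2) by simp
    next
      case (hook_notched_square m)
      then have "m = s - 5"
        using card_hook_notched_square[of m] D(3) s by simp
      then show ?thesis using hook_notched_square by simp
    qed
  next
    fix D assume "D \<in> insert (hook_notched_square (s - 5)) F"
    then consider "D = hook_notched_square (s - 5)" | k where "k \<in> K" "D = two_hooks (s - k) k"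
      by (auto simp: F_def)
    then show "D \<in> {D \<in> rook_diagrams 5 n. prod.swap ` D = D}"
    proof cases
      case 1
      then show ?thesis
        using hook_notched_square_mem[of "s - 5"] s by (simp add: algebra_simps)
    next
      case 2
      then have "4 \<le> k" "k \<le> s - k" "5 \<le> s - k" "2 * (s - k) + 2 * k - 3 = n"
        using s by (auto simp: K_def)
      then show ?thesis
        using two_hooks_mem[of k "s - k"] 2 by simp
    qed
  qed
  moreover have "hook_notched_square (s - 5) \<notin> F"
    using hook_notched_square_neq_two_hooks by (auto simp: F_def)
  moreover have "inj_on (\<lambda>k. two_hooks (s - k) k) K"
    using two_hooks_inject by (auto simp: inj_on_def K_def)
  then have "card F = s div 2 - 3" "finite F"
    by (auto simp: F_def K_def card_image)
  ultimately have "card {D \<in> rook_diagrams 5 n. prod.swap ` D = D} = Suc (s div 2 - 3)"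
    by simp
  also have "\<dots> = s div 2 - 2"
    using s(2) by linarith
  also have "s div 2 = (n + 3) div 4"
    by (simp add: s_def div_mult2_eq[symmetric])
  finally show ?thesis .
qed

theorem theorem4p7:
  fixes n :: nat
  assumes "n > 25"
  shows "([n = 5] (mod 8) \<or> [n = 7] (mod 8) \<longrightarrow> [R 5 n = 0] (mod 2)) \<and>
         ([n = 0] (mod 8) \<or> [n = 1] (mod 8) \<or> [n = 2] (mod 8) \<or> [n = 3] (mod 8) \<or>
          [n = 4] (mod 8) \<or> [n = 6] (mod 8) \<longrightarrow> [R 5 n = 1] (mod 2))"
proof -
  have parity: "even n \<longleftrightarrow> even (n mod 8)"
    by (rule dvd_mod_iff[symmetric]) simp
  show ?thesis
  proof (cases "even n")
    case True
    then have "[R 5 n = 1] (mod 2)"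
      using R_cong_self_conjugate[of 5 n] card_self_conjugate_even[OF assms] by simp
    moreover have "\<not> [n = 5] (mod 8)" "\<not> [n = 7] (mod 8)"
      using True parity by (auto simp: cong_def)
    ultimately show ?thesis by blast
  next
    case False
    then have R: "R 5 n mod 2 = ((n + 3) div 4 - 2) mod 2"
      using R_cong_self_conjugate[of 5 n] card_self_conjugate_odd[OF assms] by (simp add: cong_def)
    have "2 \<le> (n + 3) div 4"
      using assms by linarith
    have split: "n + 3 = (n mod 8 + 3) + 2 * (n div 8) * 4"
      using mult_div_mod_eq[of 8 n] by linarith
    note R
    also have "((n + 3) div 4 - 2) mod 2 = (n + 3) div 4 mod 2"
      by (rule le_mod_geq[symmetric]) fact
    also have "(n + 3) div 4 = 2 * (n div 8) + (n mod 8 + 3) div 4"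
      by (subst split, rule div_mult_self1) simp
    also have "\<dots> mod 2 = (n mod 8 + 3) div 4 mod 2"
      by (rule mod_mult_self4)
    finally have "R 5 n mod 2 = (n mod 8 + 3) div 4 mod 2" .
    moreover have "n mod 8 \<in> {1, 3, 5, 7}"
    proof -
      have "n mod 8 < 8" by simp
      then have "n mod 8 \<in> {0, 1, 2, 3, 4, 5, 6, 7}" by auto
      then show ?thesis using False parity by auto
    qed
    ultimately show ?thesis
      by (auto simp: cong_def)
  qed
qed

end
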